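(* For all integers $\ell\geq 0$ and $p\geq 0$, \begin{align*} \sum_{k=0}^\infty\frac{\binom{2k}{k}G_p(k)}{4^k(2k+2\ell+2)} &=\frac{(-1)^{p-1}}{4^\ell}\sum_{j=0}^{p-1} \left(\sum_{k=0}^\ell\frac{\binom{2\ell+1}{\ell-k}}{(2k+1)^{2p-2j}}\right) \frac{(-1)^j\left(\frac{\pi}{2}\right)^{2j+1}}{(2j+1)!} +\frac{(-1)^p}{4^\ell} \sum_{k=0}^\ell\frac{\binom{2\ell+1}{\ell-k}(-1)^k}{(2k+1)^{2p+1}},\\ \sum_{k=0}^\infty\frac{\binom{2k}{k}G_p(k)}{4^k(2k+2\ell+1)} &=\frac{(-1)^{p-1}}{4^{\ell+p}}\sum_{j=0}^{p-1} \left(\sum_{k=1}^\ell\frac{\binom{2\ell}{\ell-k}}{k^{2p-2j}}\right) \frac{(-1)^j\pi^{2j+1}}{(2j+1)!} +\frac{\binom{2\ell}{\ell}}{2^{2\ell+2p+1}}\cdot\frac{\pi^{2p+1}}{(2p+1)!}, \end{align*} and for all integers $\ell\ge 0$ and $p\geq 1$, \begin{align*} \sum_{k=1}^{\infty}\frac{4^kH_p(k)}{\binom{2k}{k}2k(2k+2\ell+1)} &=\frac{(-1)^{p-1}}{4^\ell}\sum_{j=0}^{p-1} \left(\sum_{k=0}^\ell\frac{\binom{2\ell+1}{\ell-k}}{(2k+1)^{2p-2j}}\right) \frac{(-1)^j\left(\frac{\pi}{2}\right)^{2j}}{(2j)!},\\ \sum_{k=1}^{\infty}\frac{4^kH_p(k)}{\binom{2k}{k}2k(2k+2\ell)}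 &=\frac{(-1)^{p-1}}{2^{2\ell+2p-1}}\sum_{j=0}^{p-1} \left(\sum_{k=1}^\ell\frac{\binom{2\ell}{\ell-k}}{k^{2p-2j}}\right) \frac{(-1)^j\pi^{2j}}{(2j)!} +\frac{\binom{2\ell}{\ell}}{4^{\ell+p}}\cdot\frac{\pi^{2p}}{(2p)!} +\frac{(-1)^p}{2^{2\ell+2p-1}} \sum_{k=1}^\ell\frac{\binom{2\ell}{\ell-k}(-1)^k}{k^{2p}}. \end{align*}
   Context: $G_0(k)=1$ and for $p\ge 1$, $G_p(k)=\sum_{n_1=0}^{k-1}\frac{1}{(2n_1+1)^2}\sum_{n_2=0}^{n_1-1}\frac{1}{(2n_2+1)^2}\cdots\sum_{n_p=0}^{n_{p-1}-1}\frac{1}{(2n_p+1)^2}$. $H_1(k)=1$ and for $p\ge 1$, $H_{p+1}(k)=\sum_{n_1=1}^{k-1}\frac{1}{(2n_1)^2}\sum_{n_2=1}^{n_1-1}\frac{1}{(2n_2)^2}\cdots\sum_{n_p=1}^{n_{p-1}-1}\frac{1}{(2n_p)^2}$. Empty sums are $0$. *)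

theory Defs
  imports "HOL-Analysis.Analysis"
begin

fun G :: "nat \<Rightarrow> nat \<Rightarrow> real" where
  "G 0 k = 1"
| "G (Suc p) k = (\<Sum>n<k. 1 / (2 * real n + 1)^2 * G p n)"

text \<open>The index of \<open>H\<close> starts at 1; \<open>H 0 k\<close> is deliberately left unspecified.\<close>

fun H :: "nat \<Rightarrow> nat \<Rightarrow> real" where
  "H (Suc 0) k = 1"
| "H (Suc (Suc p)) k = (\<Sum>n\<in>{1..<k}. 1 / (2 * real n)^2 * H (Suc p) n)"

end

(*
  Substituting x = sin t in the series
    cos t * sum_k binom(2k,k) G_p(k) / 4^k * sin^(2k) t = t^(2p) / (2p)!,
    cos t * sum_(k>=1) 4^k H_p(k) / (binom(2k,k) 2k) * sin^(2k-1) t = t^(2p-1) / (2p-1)!,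
  which are derivatives of the Taylor series of arcsin^q x / q!, multiplying by sin^m t and
  integrating termwise over [0, pi/2] turns each series of the theorem into the integral of
  sin^m t * t^q / q! with m = 2l+1 or m = 2l.  The integral is evaluated by writing sin^m t as a
  finite trigonometric sum and integrating by parts.
*)

theory Submission
  imports Defs
begin

text \<open>The nested sums enter only through a differential equation. Comparing coefficients links
  arcsine power p to power p - 2, and the inhomogeneous term supplies exactly the one new outermost
  summand by which \<open>G\<close> or \<open>H\<close> grows. The series are therefore defined by
  the recursion, and x = sin t, which turns the operator (1 - x^2) d^2/dx^2 - x d/dx into d^2/dt^2,
  recovers t^p / p!. The obstacle is the endpoint: t = pi/2 is x = 1, on the boundary of
  convergence, where the differentiated series is unbounded. Integration is carried out on [0, T]
  with T < pi/2; the limit may then be taken inside the sum because all coefficients are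
  nonnegative. The four formulas differ in shape because the frequencies in sin^m t have the parity
  of m. At pi/2 one of sine and cosine vanishes, which removes half of the boundary terms; the
  boundary at 0 leaves an isolated term only for sine with even powers of t and for cosine with odd
  powers.\<close>

section \<open>Taylor series of powers of the arcsine\<close>

text \<open>The coefficient of \<open>x ^ n\<close> in \<open>arcsin x ^ p / fact p\<close>; since that function \<open>f p\<close> satisfies
  \<open>(1 - x\<^sup>2) f p'' - x f p' = f (p - 2)\<close>, its coefficients obey the recursion below.\<close>

fun arcsin_coeff :: "nat \<Rightarrow> nat \<Rightarrow> real" where
  "arcsin_coeff p 0 = of_bool (p = 0)"
| "arcsin_coeff p (Suc 0) = of_bool (p = 1)"
| "arcsin_coeff p (Suc (Suc n)) =
     ((real n)\<^sup>2 * arcsin_coeff p n + (if p < 2 then 0 else arcsin_coeff (p - 2) n))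
       / ((real n + 2) * (real n + 1))"

lemma arcsin_coeff_nonneg: "0 \<le> arcsin_coeff p n"
  by (induction p n rule: arcsin_coeff.induct) auto

text \<open>The recursion preserves this crude bound because n^2 + 1 is at most (n + 2)(n + 1). It
  yields convergence on the open unit interval by comparison with a geometric series.\<close>

lemma arcsin_coeff_le_1: "arcsin_coeff p n \<le> 1"
proof (induction p n rule: arcsin_coeff.induct)
  case (3 p n)
  have "(real n)\<^sup>2 * arcsin_coeff p n \<le> (real n)\<^sup>2 * 1"
    by (rule mult_left_mono) (use 3 in auto)
  moreover have "(if p < 2 then 0 else arcsin_coeff (p - 2) n) \<le> 1"
    using 3 by auto
  moreover have "(real n)\<^sup>2 * 1 + 1 \<le> (real n + 2) * (real n + 1)"
    by (simp add: power2_eq_square algebra_simps)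
  ultimately show ?case
    by (simp add: divide_le_eq_1_pos del: of_nat_Suc)
qed auto

text \<open>Both indices move in steps of two, so the parity of \<open>p + n\<close> is inherited
  from the initial values. This later reduces each series to a single parity class of
  exponents.\<close>

lemma arcsin_coeff_parity: "odd (p + n) \<Longrightarrow> arcsin_coeff p n = 0"
  by (induction p n rule: arcsin_coeff.induct) (auto elim: oddE)

lemma arcsin_coeff_0: "arcsin_coeff 0 n = of_bool (n = 0)"
  by (induction "0 :: nat" n rule: arcsin_coeff.induct) auto

lemma summable_arcsin_coeff:
  assumes "\<bar>x\<bar> < 1"
  shows "summable (\<lambda>n. arcsin_coeff p n * x ^ n)"
proof (rule summable_comparison_test')
  show "summable (\<lambda>n. \<bar>x\<bar> ^ n)"
    using assms by (intro summable_geometric) auto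
  show "norm (arcsin_coeff p n * x ^ n) \<le> \<bar>x\<bar> ^ n" for n
    using arcsin_coeff_nonneg[of p n] arcsin_coeff_le_1[of p n]
    by (auto simp: abs_mult power_abs intro!: mult_left_le_one_le)
qed

definition arcsin_series :: "nat \<Rightarrow> real \<Rightarrow> real" where
  "arcsin_series p x = (\<Sum>n. arcsin_coeff p n * x ^ n)"

definition arcsin_series' :: "nat \<Rightarrow> real \<Rightarrow> real" where
  "arcsin_series' p x = (\<Sum>n. diffs (arcsin_coeff p) n * x ^ n)"

lemma summable_diffs_arcsin_coeff:
  assumes "\<bar>x\<bar> < 1"
  shows "summable (\<lambda>n. diffs (arcsin_coeff p) n * x ^ n)"
  by (rule termdiff_converges[where K = 1]) (use assms in \<open>auto intro: summable_arcsin_coeff\<close>)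

lemma summable_diffs2_arcsin_coeff:
  assumes "\<bar>x\<bar> < 1"
  shows "summable (\<lambda>n. diffs (diffs (arcsin_coeff p)) n * x ^ n)"
  by (rule termdiff_converges[where K = 1]) (use assms in \<open>auto intro: summable_diffs_arcsin_coeff\<close>)

lemma DERIV_arcsin_series:
  assumes "\<bar>x\<bar> < 1"
  shows "(arcsin_series p has_real_derivative arcsin_series' p x) (at x)"
  unfolding arcsin_series_def[abs_def] arcsin_series'_def
  by (rule termdiffs_strong'[where K = 1]) (use assms in \<open>auto intro: summable_arcsin_coeff\<close>)

text \<open>With n^2 = n(n - 1) + n, the recursion says coefficientwise that D equals x^2 D plus x
  times the first derivative plus the lower series. The index shifts in \<open>t1\<close> and
  \<open>t2\<close> cost nothing, since the added terms carry a zero factor.\<close>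

lemma arcsin_series_ode:
  assumes "\<bar>x\<bar> < 1"
  shows "\<exists>D. (arcsin_series' p has_real_derivative D) (at x) \<and>
           (1 - x\<^sup>2) * D - x * arcsin_series' p x = (if p < 2 then 0 else arcsin_series (p - 2) x)"
proof -
  let ?a = "arcsin_coeff p"
  define b where "b n = (if p < 2 then 0 else arcsin_coeff (p - 2) n)" for n
  define D where "D = (\<Sum>n. diffs (diffs ?a) n * x ^ n)"
  have "(arcsin_series' p has_real_derivative D) (at x)"
    unfolding arcsin_series'_def[abs_def] D_def
    by (rule termdiffs_strong'[where K = 1]) (use assms in \<open>auto intro: summable_diffs_arcsin_coeff\<close>)
  have s2: "(\<lambda>n. diffs (diffs ?a) n * x ^ n) sums D"
    unfolding D_def using summable_diffs2_arcsin_coeff[OF assms] by (rule summable_sums)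
  have s1: "(\<lambda>n. diffs ?a n * x ^ n) sums arcsin_series' p x"
    unfolding arcsin_series'_def using summable_diffs_arcsin_coeff[OF assms] by (rule summable_sums)
  have s0: "(\<lambda>n. b n * x ^ n) sums (if p < 2 then 0 else arcsin_series (p - 2) x)"
    unfolding arcsin_series_def b_def
    using summable_sums[OF summable_arcsin_coeff[OF assms]] by auto
  have t1: "(\<lambda>n. real n * ?a n * x ^ n) sums (x * arcsin_series' p x)"
  proof -
    have "(\<lambda>n. real (Suc n) * ?a (Suc n) * x ^ Suc n) sums (x * arcsin_series' p x)"
      using sums_mult[OF s1, of x] by (simp add: diffs_def mult_ac)
    then show ?thesis
      by (subst (asm) sums_Suc_iff[of "\<lambda>n. real n * ?a n * x ^ n"]) simp
  qed
  have t2: "(\<lambda>n. real n * (real n - 1) * ?a n * x ^ n) sums (x\<^sup>2 * D)"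
  proof -
    let ?f = "\<lambda>n. real n * (real n - 1) * ?a n * x ^ n"
    have "(\<lambda>n. ?f (Suc (Suc n))) sums (x\<^sup>2 * D)"
      using sums_mult[OF s2, of "x\<^sup>2"] by (simp add: diffs_def mult_ac power2_eq_square add_ac)
    then have "(\<lambda>n. ?f (Suc n)) sums (x\<^sup>2 * D)"
      by (subst (asm) sums_Suc_iff[of "\<lambda>n. ?f (Suc n)"]) simp
    then show ?thesis
      by (subst (asm) sums_Suc_iff[of ?f]) simp
  qed
  have "diffs (diffs ?a) n * x ^ n
          = real n * (real n - 1) * ?a n * x ^ n + real n * ?a n * x ^ n + b n * x ^ n" for n
  proof -
    have "diffs (diffs ?a) n = (real n + 2) * (real n + 1) * ?a (Suc (Suc n))"
      by (simp add: diffs_def add_ac)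
    also have "\<dots> = (real n)\<^sup>2 * ?a n + b n"
      by (simp add: b_def del: of_nat_Suc)
    finally show ?thesis
      by (simp add: algebra_simps power2_eq_square)
  qed
  then have "D = x\<^sup>2 * D + x * arcsin_series' p x
                  + (if p < 2 then 0 else arcsin_series (p - 2) x)"
    using sums_add[OF sums_add[OF t2 t1] s0] s2 by (simp only: sums_unique2)
  then show ?thesis
    using \<open>(arcsin_series' p has_real_derivative D) (at x)\<close>
    by (intro exI[of _ D]) (auto simp: algebra_simps)
qed

lemma arcsin_series_0 [simp]: "arcsin_series p 0 = of_bool (p = 0)"
  and arcsin_series'_0 [simp]: "arcsin_series' p 0 = of_bool (p = 1)"
  by (simp_all add: arcsin_series_def arcsin_series'_def diffs_def)

lemma abs_sin_less_1:
  assumes "\<bar>t\<bar> < pi / 2"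
  shows "\<bar>sin t\<bar> < 1"
proof -
  have "0 < cos t"
    using assms by (intro cos_gt_zero_pi) auto
  then have "(sin t)\<^sup>2 < 1"
    by (simp add: sin_squared_eq)
  then show ?thesis
    by (simp add: abs_square_less_1)
qed

lemma DERIV_zero_imp_eq_0:
  assumes "\<And>t. \<bar>t\<bar> < r \<Longrightarrow> (W has_real_derivative 0) (at t)" "W 0 = 0" "\<bar>t\<bar> < r"
  shows "W t = (0 :: real)"
proof -
  have "W t = W 0"
    by (rule DERIV_isconst3[of "-r" r]) (use assms in auto)
  with assms show ?thesis by simp
qed

lemma DERIV_power_fact:
  "((\<lambda>t. t ^ Suc p / fact (Suc p)) has_real_derivative t ^ p / fact p) (at t within A)"
  by (rule derivative_eq_intros refl | simp)+

text \<open>The derivative of \<open>arcsin_series' p (sin t) * cos t\<close> is the left side of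
  the differential equation at sin t, hence the series for p - 2, known by strong induction. Two
  integrations from 0 give both claims.\<close>

lemma arcsin_series_sin_aux:
  assumes "\<bar>t\<bar> < pi / 2"
  shows "arcsin_series p (sin t) = t ^ p / fact p \<and>
         arcsin_series' p (sin t) * cos t = (if p = 0 then 0 else t ^ (p - 1) / fact (p - 1))"
  using assms
proof (induction p arbitrary: t rule: less_induct)
  case (less p)
  \<comment> \<open>\<open>q\<close> and \<open>r\<close> are the first and second derivatives of
    t^p / p!. The case splits are essential: truncated subtraction would otherwise produce 1 instead
    of 0 for small p.\<close>
  define q where "q t = (if p = 0 then 0 else t ^ (p - 1) / fact (p - 1))" for t :: real
  define r where "r t = (if p < 2 then 0 else t ^ (p - 2) / fact (p - 2))" for t :: real
  have r: "(if p < 2 then 0 else arcsin_series (p - 2) (sin s)) = r s" if "\<bar>s\<bar> < pi / 2" for s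
    using less.IH[of "p - 2" s] that by (auto simp: r_def)
  have dq: "(q has_real_derivative r s) (at s)" for s
  proof (cases "p < 2")
    case True
    then have "p = 0 \<or> p = 1" by auto
    then show ?thesis by (auto simp: q_def[abs_def] r_def)
  next
    case False
    then obtain p' where "p = Suc (Suc p')"
      by (metis One_nat_def Suc_1 Suc_lessI not0_implies_Suc not_less_eq zero_less_Suc)
    then show ?thesis using DERIV_power_fact[of p' s UNIV] by (simp add: q_def[abs_def] r_def)
  qed
  have dp: "((\<lambda>t. t ^ p / fact p) has_real_derivative q s) (at s)" for s
    using DERIV_power_fact[of "p - 1" s UNIV] by (cases p) (simp_all add: q_def)
  \<comment> \<open>First integration: the difference has derivative zero, and at 0 both terms equal
    1 if p = 1 and 0 otherwise.\<close>
  have D1: "arcsin_series' p (sin s) * cos s - q s = 0" if "\<bar>s\<bar> < pi / 2" for s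
  proof (rule DERIV_zero_imp_eq_0[where r = "pi / 2" and W = "\<lambda>s. arcsin_series' p (sin s) * cos s - q s"])
    fix u :: real assume u: "\<bar>u\<bar> < pi / 2"
    obtain D where D: "(arcsin_series' p has_real_derivative D) (at (sin u))"
      "D * (1 - (sin u)\<^sup>2) - sin u * arcsin_series' p (sin u) = r u"
      using arcsin_series_ode[OF abs_sin_less_1[OF u], of p] r[OF u] by (auto simp: mult.commute)
    have cos_eq: "x * cos u * cos u = x * (1 - (sin u)\<^sup>2)" for x
      by (simp add: mult.assoc flip: power2_eq_square cos_squared_eq)
    show "((\<lambda>s. arcsin_series' p (sin s) * cos s - q s) has_real_derivative 0) (at u)"
      by (rule derivative_eq_intros DERIV_chain2[where f = "arcsin_series' p" and g = sin, OF D(1)] dq refl)+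
         (use D(2) in \<open>simp add: cos_eq\<close>)
  qed (use that in \<open>auto simp: q_def\<close>)
  have "arcsin_series p (sin t) - t ^ p / fact p = 0"
  proof (rule DERIV_zero_imp_eq_0[where r = "pi / 2" and W = "\<lambda>t. arcsin_series p (sin t) - t ^ p / fact p"])
    fix u :: real assume u: "\<bar>u\<bar> < pi / 2"
    show "((\<lambda>t. arcsin_series p (sin t) - t ^ p / fact p) has_real_derivative 0) (at u)"
      by (rule derivative_eq_intros DERIV_chain2[where f = "arcsin_series p" and g = sin, OF DERIV_arcsin_series] abs_sin_less_1[OF u] dp refl)+
         (use D1[OF u] in simp)
  qed (use less.prems in auto)
  with D1[OF less.prems] show ?case by (simp add: q_def)
qed

lemma arcsin_series'_sin:
  assumes "\<bar>t\<bar> < pi / 2"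
  shows "arcsin_series' (Suc p) (sin t) * cos t = t ^ p / fact p"
  using arcsin_series_sin_aux[OF assms, of "Suc p"] by simp

section \<open>Termwise integration up to the singularity\<close>

text \<open>A converse of Abel's theorem in which nonnegativity is the Tauberian condition. Each
  partial sum at 1 is a limit of partial sums at x < 1, which lie below the full series there, so it
  is at most L; conversely, the series at x is at most the sum at 1.\<close>

lemma nonneg_tauberian:
  fixes e :: "nat \<Rightarrow> real"
  assumes nonneg: "\<And>n. 0 \<le> e n"
    and summable: "\<And>x. 0 < x \<Longrightarrow> x < 1 \<Longrightarrow> summable (\<lambda>n. e n * x ^ n)"
    and lim: "((\<lambda>x. \<Sum>n. e n * x ^ n) \<longlongrightarrow> L) (at_left 1)"
  shows "e sums L"
proof -
  let ?f = "\<lambda>x. \<Sum>n. e n * x ^ n"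
  have ev: "eventually (\<lambda>x::real. 0 < x \<and> x < 1) (at_left 1)"
    by (rule eventually_at_leftI[of 0]) auto
  have part: "(\<Sum>n<N. e n) \<le> L" for N
  proof (rule tendsto_le[OF _ lim])
    have "((\<lambda>x. \<Sum>n<N. e n * x ^ n) \<longlongrightarrow> (\<Sum>n<N. e n * 1 ^ n)) (at_left 1)"
      by (intro tendsto_intros)
    then show "((\<lambda>x. \<Sum>n<N. e n * x ^ n) \<longlongrightarrow> (\<Sum>n<N. e n)) (at_left 1)" by simp
    show "eventually (\<lambda>x. (\<Sum>n<N. e n * x ^ n) \<le> ?f x) (at_left 1)"
      using ev by eventually_elim (auto intro!: sum_le_suminf summable nonneg mult_nonneg_nonneg)
  qed simp
  have sm: "summable e"
    by (rule summableI_nonneg_bounded[OF nonneg part])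
  have "suminf e \<le> L"
    by (rule suminf_le_const[OF sm part])
  moreover have "L \<le> suminf e"
  proof (rule tendsto_upperbound[OF lim])
    show "eventually (\<lambda>x. ?f x \<le> suminf e) (at_left 1)"
      using ev
    proof eventually_elim
      case (elim x)
      then have "e n * x ^ n \<le> e n" for n
        using nonneg[of n] by (intro mult_right_le_one_le) (auto intro: power_le_one)
      then show ?case using elim by (intro suminf_le summable sm) auto
    qed
  qed simp
  ultimately show ?thesis using sm by (metis order_antisym summable_sums)
qed

text \<open>Dividing the coefficients of the differentiated series by n + m + 1 makes x^(m+1) f(x)
  an antiderivative of x^m times that series. After x = sin t this is the integral of
  \<open>g\<close>, which stays continuous up to pi/2.\<close>

lemma sums_integral_sin_power:
  assumes "((\<lambda>t. sin t ^ m * (t ^ p / fact p)) has_integral L) {0..pi / 2}"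
  shows "(\<lambda>n. real (Suc n) * arcsin_coeff (Suc p) (Suc n) / real (n + m + 1)) sums L"
proof -
  define c where "c = diffs (arcsin_coeff (Suc p))"
  define e where "e n = c n / real (n + m + 1)" for n
  define g where "g t = sin t ^ m * (t ^ p / fact p)" for t :: real
  define f where "f x = (\<Sum>n. e n * x ^ n)" for x
  have c_nonneg: "0 \<le> c n" for n
    by (simp add: c_def diffs_def arcsin_coeff_nonneg)
  then have e_nonneg: "0 \<le> e n" for n
    by (simp add: e_def)
  have e_le: "e n \<le> c n" for n
    using c_nonneg[of n] mult_right_mono[of 1 "real (n + m + 1)" "c n"] by (simp add: e_def divide_le_eq mult_ac)
  have summable_e: "summable (\<lambda>n. e n * x ^ n)" if "\<bar>x\<bar> < 1" for x
  proof (rule summable_comparison_test')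
    show "summable (\<lambda>n. c n * \<bar>x\<bar> ^ n)"
      unfolding c_def by (rule summable_diffs_arcsin_coeff) (use that in simp)
    show "norm (e n * x ^ n) \<le> c n * \<bar>x\<bar> ^ n" for n
      using e_nonneg[of n] e_le[of n] by (simp add: abs_mult power_abs mult_right_mono)
  qed
  have g_cont: "continuous_on A g" for A
    unfolding g_def by (intro continuous_intros) auto
  \<comment> \<open>Differentiating the candidate replaces termwise integration: x f' + (m + 1) f
    multiplies the n-th coefficient by n + m + 1 and so restores \<open>c n\<close>.\<close>
  have DF: "((\<lambda>x. x ^ Suc m * f x) has_real_derivative x ^ m * arcsin_series' (Suc p) x) (at x)"
    if x: "\<bar>x\<bar> < 1" for x
  proof -
    have df: "(f has_real_derivative (\<Sum>n. diffs e n * x ^ n)) (at x)"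
      unfolding f_def[abs_def]
      by (rule termdiffs_strong'[where K = 1]) (use x in \<open>auto intro: summable_e\<close>)
    have "summable (\<lambda>n. diffs e n * x ^ n)"
      by (rule termdiff_converges[where K = 1]) (use x in \<open>auto intro: summable_e\<close>)
    then have "(\<lambda>n. x * (diffs e n * x ^ n)) sums (x * (\<Sum>n. diffs e n * x ^ n))"
      by (intro sums_mult summable_sums)
    then have "(\<lambda>n. real (Suc n) * e (Suc n) * x ^ Suc n) sums (x * (\<Sum>n. diffs e n * x ^ n))"
      by (simp add: diffs_def mult_ac)
    then have "(\<lambda>n. real n * e n * x ^ n) sums (x * (\<Sum>n. diffs e n * x ^ n))"
      by (subst (asm) sums_Suc_iff[of "\<lambda>n. real n * e n * x ^ n"]) simp
    moreover have "(\<lambda>n. real (Suc m) * (e n * x ^ n)) sums (real (Suc m) * f x)"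
      unfolding f_def by (intro sums_mult summable_sums summable_e x)
    ultimately have "(\<lambda>n. real n * e n * x ^ n + real (Suc m) * (e n * x ^ n)) sums
                       (x * (\<Sum>n. diffs e n * x ^ n) + real (Suc m) * f x)"
      by (rule sums_add)
    moreover have "real n * e n * x ^ n + real (Suc m) * (e n * x ^ n) = c n * x ^ n" for n
    proof -
      have "c n = real (n + m + 1) * e n" by (simp add: e_def)
      then show ?thesis by (simp add: algebra_simps)
    qed
    ultimately have "arcsin_series' (Suc p) x = x * (\<Sum>n. diffs e n * x ^ n) + real (Suc m) * f x"
      unfolding arcsin_series'_def c_def[symmetric] by (simp add: sums_iff)
    then show ?thesis
      by (intro DERIV_cong[OF DERIV_mult[OF DERIV_pow df]]) (simp add: algebra_simps)
  qed
  have F_eq: "sin T ^ Suc m * f (sin T) = integral {0..T} g" if T: "0 \<le> T" "T < pi / 2" for T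
  proof -
    have "(g has_integral (sin T ^ Suc m * f (sin T) - sin 0 ^ Suc m * f (sin 0))) {0..T}"
    proof (rule fundamental_theorem_of_calculus)
      fix t assume "t \<in> {0..T}"
      then have t: "\<bar>t\<bar> < pi / 2" using T by auto
      have "((\<lambda>t. sin t ^ Suc m * f (sin t)) has_real_derivative g t) (at t)"
        by (rule DERIV_cong[OF DERIV_chain2[OF DF[OF abs_sin_less_1[OF t]] DERIV_sin]])
           (simp add: g_def mult_ac flip: arcsin_series'_sin[OF t])
      then show "((\<lambda>t. sin t ^ Suc m * f (sin t)) has_vector_derivative g t) (at t within {0..T})"
        by (simp add: has_real_derivative_iff_has_vector_derivative has_vector_derivative_at_within)
    qed (use T in auto)
    then show ?thesis by (simp add: integral_unique)
  qed
  \<comment> \<open>The endpoint is reached here: the integral as a function of its upper limit is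
    continuous on the closed interval, and so is the arcsine, hence its limit as x tends to 1 from
    the left is L.\<close>
  have "continuous_on {0..1} (\<lambda>x. integral {0..arcsin x} g)"
  proof (rule continuous_on_compose2[where g = "\<lambda>T. integral {0..T} g" and f = arcsin])
    show "continuous_on {0..pi / 2} (\<lambda>T. integral {0..T} g)"
      by (intro indefinite_integral_continuous_1 integrable_continuous_real g_cont)
    show "continuous_on {0..1} arcsin"
      by (rule continuous_on_subset[OF continuous_on_arcsin']) auto
    show "arcsin ` {0..1} \<subseteq> {0..pi / 2}"
      using arcsin_nonneg arcsin_ubound by fastforce
  qed
  then have "((\<lambda>x. integral {0..arcsin x} g) \<longlongrightarrow> integral {0..arcsin 1} g) (at 1 within {0..1})"
    unfolding continuous_on_def by (rule bspec) simp
  then have lim: "((\<lambda>x. integral {0..arcsin x} g) \<longlongrightarrow> L) (at_left 1)"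
    using integral_unique[OF assms[folded g_def]] by (simp add: at_within_Icc_at_left)
  have "((\<lambda>x. integral {0..arcsin x} g / x ^ Suc m) \<longlongrightarrow> L / 1 ^ Suc m) (at_left 1)"
    by (intro tendsto_intros lim) auto
  moreover have "eventually (\<lambda>x. f x = integral {0..arcsin x} g / x ^ Suc m) (at_left 1)"
  proof -
    have "eventually (\<lambda>x::real. 0 < x \<and> x < 1) (at_left 1)"
      by (rule eventually_at_leftI[of 0]) auto
    then show ?thesis
    proof eventually_elim
      case (elim x)
      then have "arcsin x < pi / 2" "0 \<le> arcsin x" "sin (arcsin x) = x"
        using arcsin_lt_bounded[of x] by (auto intro: arcsin_nonneg)
      then show ?case using F_eq[of "arcsin x"] elim by (simp add: field_simps)
    qed
  qed
  ultimately have "(f \<longlongrightarrow> L) (at_left 1)"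
    by (simp add: tendsto_cong)
  then have "e sums L"
    unfolding f_def[abs_def] by (intro nonneg_tauberian e_nonneg summable_e) auto
  then show ?thesis
    by (simp add: e_def[abs_def] c_def diffs_def)
qed

section \<open>Powers of the sine as trigonometric sums\<close>

text \<open>Real part of the binomial expansion of (e^(iu) + e^(-iu))^n; the reversed sign of the
  frequency is harmless because cosine is even.\<close>

lemma cos_power_binomial:
  "(2 * cos u) ^ n = (\<Sum>j\<le>n. real (n choose j) * cos ((real n - 2 * real j) * u))"
proof -
  have "complex_of_real ((2 * cos u) ^ n) = (cis u + cis (- u)) ^ n"
    by (simp add: complex_eq_iff cis.ctr complex_of_real_def[symmetric] flip: of_real_power) 
  also have "\<dots> = (\<Sum>j\<le>n. of_nat (n choose j) * cis u ^ j * cis (- u) ^ (n - j))"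
    by (rule binomial_ring)
  also have "\<dots> = (\<Sum>j\<le>n. of_nat (n choose j) * cis (- ((real n - 2 * real j) * u)))"
  proof (intro sum.cong refl)
    fix j assume "j \<in> {..n}"
    then have "real j * u + real (n - j) * - u = - ((real n - 2 * real j) * u)"
      by (simp add: of_nat_diff algebra_simps)
    then have "cis u ^ j * cis (- u) ^ (n - j) = cis (- ((real n - 2 * real j) * u))"
      by (simp only: Complex.DeMoivre cis_mult)
    then show "of_nat (n choose j) * cis u ^ j * cis (- u) ^ (n - j)
        = of_nat (n choose j) * cis (- ((real n - 2 * real j) * u))"
      by (simp only: mult.assoc)
  qed
  finally have "Re (complex_of_real ((2 * cos u) ^ n))
      = Re (\<Sum>j\<le>n. of_nat (n choose j) * cis (- ((real n - 2 * real j) * u)))" by simp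
  then show ?thesis by (simp del: of_real_power of_real_mult)
qed

text \<open>Write sin t = cos (t - pi/2). The terms j and 2l + 1 - j agree, so the sum is twice its
  first half, and j = l - k has frequency 2k + 1. The phase (2k + 1) pi/2 turns the cosine into
  (-1)^k times a sine.\<close>

lemma sin_power_odd:
  "sin t ^ (2 * l + 1) =
     (\<Sum>k=0..l. real ((2 * l + 1) choose (l - k)) * (-1) ^ k * sin ((2 * real k + 1) * t)) / 4 ^ l"
proof -
  define u where "u = t - pi / 2"
  let ?n = "2 * l + 1"
  define h where "h j = real (?n choose j) * cos ((real ?n - 2 * real j) * u)" for j
  have sin: "sin t = cos u"
    by (simp add: u_def cos_diff)
  have pow: "(2 * sin t) ^ ?n = 2 * 4 ^ l * sin t ^ ?n"
    by (simp add: power_mult power_mult_distrib)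
  have refl_h: "h (?n - j) = h j" if "j \<le> ?n" for j
  proof -
    have "(real ?n - 2 * real (?n - j)) * u = - ((real ?n - 2 * real j) * u)"
      using that by (simp add: of_nat_diff algebra_simps)
    then show ?thesis
      using that binomial_symmetric[OF that] by (simp add: h_def)
  qed
  have "(2 * sin t) ^ ?n = (\<Sum>j\<le>?n. h j)"
    unfolding h_def sin by (rule cos_power_binomial)
  also have "\<dots> = (\<Sum>j\<in>{..l}. h j) + (\<Sum>j\<in>{l+1..?n}. h j)"
    by (subst sum.union_disjoint[symmetric]) (auto intro!: sum.cong arg_cong2[where f = sum] simp del: sum.atMost_Suc)
  also have "(\<Sum>j\<in>{l+1..?n}. h j) = (\<Sum>j\<in>{..l}. h j)"
    by (rule sum.reindex_bij_witness[of _ "\<lambda>j. ?n - j" "\<lambda>j. ?n - j"])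
       (use refl_h in auto)
  also have "(\<Sum>j\<in>{..l}. h j) = (\<Sum>k=0..l. h (l - k))"
    by (rule sum.reindex_bij_witness[of _ "\<lambda>j. l - j" "\<lambda>j. l - j"]) auto
  also have "(\<Sum>k=0..l. h (l - k)) = (\<Sum>k=0..l. real (?n choose (l - k)) * (-1) ^ k * sin ((2 * real k + 1) * t))"
  proof (rule sum.cong)
    fix k assume "k \<in> {0..l}"
    then have "(real ?n - 2 * real (l - k)) * u = (2 * real k + 1) * t - real k * pi - pi / 2"
      by (simp add: u_def of_nat_diff algebra_simps)
    then have "cos ((real ?n - 2 * real (l - k)) * u) = (-1) ^ k * sin ((2 * real k + 1) * t)"
      by (simp add: cos_diff sin_diff del: of_nat_add of_nat_mult)
    then show "h (l - k) = real (?n choose (l - k)) * (-1) ^ k * sin ((2 * real k + 1) * t)"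
      by (simp add: h_def)
  qed simp
  finally show ?thesis
    unfolding pow by (simp add: field_simps)
qed

text \<open>The same folding, except that the middle term j = l has no partner and stays undoubled
  as the constant mode. The phase is now k pi, so cosines remain cosines.\<close>

lemma sin_power_even:
  "sin t ^ (2 * l) =
     (real ((2 * l) choose l) +
      2 * (\<Sum>k=1..l. real ((2 * l) choose (l - k)) * (-1) ^ k * cos (2 * real k * t))) / 4 ^ l"
proof -
  define u where "u = t - pi / 2"
  let ?n = "2 * l"
  define h where "h j = real (?n choose j) * cos ((real ?n - 2 * real j) * u)" for j
  have sin: "sin t = cos u"
    by (simp add: u_def cos_diff)
  have pow: "(2 * sin t) ^ ?n = 4 ^ l * sin t ^ ?n"
    by (simp add: power_mult power_mult_distrib)
  have refl_h: "h (?n - j) = h j" if "j \<le> ?n" for j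
  proof -
    have "(real ?n - 2 * real (?n - j)) * u = - ((real ?n - 2 * real j) * u)"
      using that by (simp add: of_nat_diff algebra_simps)
    then show ?thesis
      using that binomial_symmetric[OF that] by (simp add: h_def)
  qed
  have "(2 * sin t) ^ ?n = (\<Sum>j\<le>?n. h j)"
    unfolding h_def sin by (rule cos_power_binomial)
  also have "{..?n} = insert l ({..<l} \<union> {l+1..?n})"
    by auto
  also have "sum h \<dots> = h l + ((\<Sum>j\<in>{..<l}. h j) + (\<Sum>j\<in>{l+1..?n}. h j))"
    by (simp, subst sum.union_disjoint) auto
  also have "(\<Sum>j\<in>{l+1..?n}. h j) = (\<Sum>j\<in>{..<l}. h j)"
    by (rule sum.reindex_bij_witness[of _ "\<lambda>j. ?n - j" "\<lambda>j. ?n - j"])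
       (use refl_h in auto)
  also have "(\<Sum>j\<in>{..<l}. h j) = (\<Sum>k=1..l. h (l - k))"
    by (rule sum.reindex_bij_witness[of _ "\<lambda>j. l - j" "\<lambda>j. l - j"]) auto
  also have "(\<Sum>k=1..l. h (l - k)) = (\<Sum>k=1..l. real (?n choose (l - k)) * (-1) ^ k * cos (2 * real k * t))"
  proof (rule sum.cong)
    fix k assume "k \<in> {1..l}"
    then have "(real ?n - 2 * real (l - k)) * u = 2 * real k * t - real k * pi"
      by (simp add: u_def of_nat_diff algebra_simps)
    then have "cos ((real ?n - 2 * real (l - k)) * u) = (-1) ^ k * cos (2 * real k * t)"
      by (simp add: cos_diff del: of_nat_mult)
    then show "h (l - k) = real (?n choose (l - k)) * (-1) ^ k * cos (2 * real k * t)"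
      by (simp add: h_def)
  qed simp
  also have "h l = real (?n choose l)"
    by (simp add: h_def)
  finally show ?thesis
    unfolding pow by (simp add: field_simps)
qed

section \<open>Moments of sine and cosine\<close>

lemma has_integral_DERIV_from_0:
  fixes F :: "real \<Rightarrow> real"
  assumes "\<And>t. (F has_real_derivative f t) (at t)" "0 \<le> b"
  shows "(f has_integral F b - F 0) {0..b}"
  using assms
  by (intro fundamental_theorem_of_calculus)
     (auto simp flip: has_real_derivative_iff_has_vector_derivative intro: DERIV_subset)

lemma has_integral_power_sin_step:
  fixes a b :: real
  assumes "((\<lambda>t. t ^ p / fact p * sin (a * t)) has_integral I) {0..b}" "a \<noteq> 0" "0 \<le> b"
  shows "((\<lambda>t. t ^ (p + 2) / fact (p + 2) * sin (a * t)) has_integral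
           (b ^ (p + 1) / fact (p + 1) * sin (a * b) / a\<^sup>2
             - b ^ (p + 2) / fact (p + 2) * cos (a * b) / a - I / a\<^sup>2)) {0..b}"
proof -
  define P where "P q t = t ^ q / fact q" for q and t :: real
  \<comment> \<open>Two integrations by parts in one antiderivative: the mixed terms with
    \<open>P (Suc p)\<close> cancel in the derivative of \<open>J\<close>, and J 0 = 0 because both
    powers of t are positive.\<close>
  define J where "J t = P (Suc p) t * sin (a * t) / a\<^sup>2 - P (Suc (Suc p)) t * cos (a * t) / a" for t
  have P: "(P (Suc q) has_real_derivative P q t) (at t within A)" for q t A
    unfolding P_def[abs_def] by (rule DERIV_power_fact)
  have "((\<lambda>t. P (Suc (Suc p)) t * sin (a * t) + (P p t * sin (a * t)) / a\<^sup>2)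
          has_integral (J b - J 0)) {0..b}"
  proof (rule has_integral_DERIV_from_0)
    fix t
    show "(J has_real_derivative
            P (Suc (Suc p)) t * sin (a * t) + (P p t * sin (a * t)) / a\<^sup>2) (at t)"
      unfolding J_def[abs_def]
      by (rule derivative_eq_intros P refl | use assms in \<open>simp add: power2_eq_square field_simps\<close>)+
  qed fact
  from has_integral_diff[OF this has_integral_divide[OF assms(1), of "a\<^sup>2"]]
  show ?thesis by (simp add: J_def P_def numeral_2_eq_2 del: fact_Suc power_Suc)
qed

lemma has_integral_power_cos_step:
  fixes a b :: real
  assumes "((\<lambda>t. t ^ p / fact p * cos (a * t)) has_integral I) {0..b}" "a \<noteq> 0" "0 \<le> b"
  shows "((\<lambda>t. t ^ (p + 2) / fact (p + 2) * cos (a * t)) has_integral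
           (b ^ (p + 1) / fact (p + 1) * cos (a * b) / a\<^sup>2
             + b ^ (p + 2) / fact (p + 2) * sin (a * b) / a - I / a\<^sup>2)) {0..b}"
proof -
  define P where "P q t = t ^ q / fact q" for q and t :: real
  define J where "J t = P (Suc p) t * cos (a * t) / a\<^sup>2 + P (Suc (Suc p)) t * sin (a * t) / a" for t
  have P: "(P (Suc q) has_real_derivative P q t) (at t within A)" for q t A
    unfolding P_def[abs_def] by (rule DERIV_power_fact)
  have "((\<lambda>t. P (Suc (Suc p)) t * cos (a * t) + (P p t * cos (a * t)) / a\<^sup>2)
          has_integral (J b - J 0)) {0..b}"
  proof (rule has_integral_DERIV_from_0)
    fix t
    show "(J has_real_derivative
            P (Suc (Suc p)) t * cos (a * t) + (P p t * cos (a * t)) / a\<^sup>2) (at t)"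
      unfolding J_def[abs_def]
      by (rule derivative_eq_intros P refl | use assms in \<open>simp add: power2_eq_square field_simps\<close>)+
  qed fact
  from has_integral_diff[OF this has_integral_divide[OF assms(1), of "a\<^sup>2"]]
  show ?thesis by (simp add: J_def P_def numeral_2_eq_2 del: fact_Suc power_Suc)
qed

lemma has_integral_sin:
  fixes a b :: real
  assumes "a \<noteq> 0" "0 \<le> b"
  shows "((\<lambda>t. sin (a * t)) has_integral (1 - cos (a * b)) / a) {0..b}"
proof -
  have "((\<lambda>t. sin (a * t)) has_integral (- cos (a * b) / a - - cos (a * 0) / a)) {0..b}"
    by (rule has_integral_DERIV_from_0[where F = "\<lambda>t. - cos (a * t) / a"])
       (use assms in \<open>auto intro!: derivative_eq_intros\<close>)
  then show ?thesis by (simp add: diff_divide_distrib)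
qed

lemma has_integral_id_times_sin:
  fixes a b :: real
  assumes "a \<noteq> 0" "0 \<le> b"
  shows "((\<lambda>t. t * sin (a * t)) has_integral sin (a * b) / a\<^sup>2 - b * cos (a * b) / a) {0..b}"
proof -
  have "((\<lambda>t. t * sin (a * t)) has_integral
          ((sin (a * b) / a\<^sup>2 - b * cos (a * b) / a) - (sin (a * 0) / a\<^sup>2 - 0 * cos (a * 0) / a))) {0..b}"
    by (rule has_integral_DERIV_from_0[where F = "\<lambda>t. sin (a * t) / a\<^sup>2 - t * cos (a * t) / a"])
       (use assms in \<open>auto intro!: derivative_eq_intros simp: power2_eq_square field_simps\<close>)
  then show ?thesis by simp
qed

lemma has_integral_cos:
  fixes a b :: real
  assumes "a \<noteq> 0" "0 \<le> b"
  shows "((\<lambda>t. cos (a * t)) has_integral sin (a * b) / a) {0..b}"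
proof -
  have "((\<lambda>t. cos (a * t)) has_integral (sin (a * b) / a - sin (a * 0) / a)) {0..b}"
    by (rule has_integral_DERIV_from_0[where F = "\<lambda>t. sin (a * t) / a"])
       (use assms in \<open>auto intro!: derivative_eq_intros\<close>)
  then show ?thesis by simp
qed

lemma has_integral_id_times_cos:
  fixes a b :: real
  assumes "a \<noteq> 0" "0 \<le> b"
  shows "((\<lambda>t. t * cos (a * t)) has_integral (cos (a * b) - 1) / a\<^sup>2 + b * sin (a * b) / a) {0..b}"
proof -
  have "((\<lambda>t. t * cos (a * t)) has_integral
          ((cos (a * b) / a\<^sup>2 + b * sin (a * b) / a) - (cos (a * 0) / a\<^sup>2 + 0 * sin (a * 0) / a))) {0..b}"
    by (rule has_integral_DERIV_from_0[where F = "\<lambda>t. cos (a * t) / a\<^sup>2 + t * sin (a * t) / a"])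
       (use assms in \<open>auto intro!: derivative_eq_intros simp: power2_eq_square field_simps\<close>)
  then show ?thesis by (simp add: diff_divide_distrib algebra_simps)
qed

lemma has_integral_power_fact:
  fixes b :: real
  assumes "0 \<le> b"
  shows "((\<lambda>t. t ^ p / fact p) has_integral b ^ Suc p / fact (Suc p)) {0..b}"
  using has_integral_DERIV_from_0[OF DERIV_power_fact[of p] assms] by simp

text \<open>Closed form of the boundary terms accumulated by repeated integration by parts with
  frequency a; each step divides by a^2 and flips the sign. Summed over the frequencies with
  weights, it gives the double sums of the theorem.\<close>

definition alt_sum :: "(nat \<Rightarrow> real) \<Rightarrow> real \<Rightarrow> nat \<Rightarrow> real" where
  "alt_sum c a p = (\<Sum>j<p. (-1) ^ j * c j / a ^ (2 * p - 2 * j))"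

lemma alt_sum_0 [simp]: "alt_sum c a 0 = 0"
  by (simp add: alt_sum_def)

lemma alt_sum_Suc: "alt_sum c a (Suc p) = (alt_sum c a p + (-1) ^ p * c p) / a\<^sup>2"
proof -
  have "(\<Sum>j<p. (-1) ^ j * c j / a ^ (2 * Suc p - 2 * j)) = alt_sum c a p / a\<^sup>2"
    unfolding alt_sum_def sum_divide_distrib
  proof (rule sum.cong)
    fix j assume "j \<in> {..<p}"
    then have "2 * Suc p - 2 * j = (2 * p - 2 * j) + 2" by auto
    then show "(-1) ^ j * c j / a ^ (2 * Suc p - 2 * j) = (-1) ^ j * c j / a ^ (2 * p - 2 * j) / a\<^sup>2"
      by (simp only: power_add divide_divide_eq_left)
  qed simp
  then show ?thesis
    by (simp add: alt_sum_def[of _ _ "Suc p"] add_divide_distrib)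
qed

text \<open>Since cos (a b) vanishes, each step contributes only its sine boundary term. The
  isolated power of 1/a descends from the lower endpoint of the initial integral of sin (a
  t).\<close>

lemma has_integral_even_power_sin:
  fixes a b :: real
  assumes "a \<noteq> 0" "0 \<le> b" "cos (a * b) = 0"
  shows "((\<lambda>t. t ^ (2 * p) / fact (2 * p) * sin (a * t)) has_integral
           (-1) ^ p * (1 / a ^ (2 * p + 1)
             - sin (a * b) * alt_sum (\<lambda>j. b ^ (2 * j + 1) / fact (2 * j + 1)) a p)) {0..b}"
proof (induction p)
  case 0
  show ?case using has_integral_sin[OF assms(1,2)] assms(3) by simp
next
  case (Suc p)
  define C where "C = b ^ (2 * p + 1) / fact (2 * p + 1)"
  have idx: "2 * Suc p = 2 * p + 2" by simp
  show ?case
    unfolding alt_sum_Suc C_def[symmetric] idx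
    by (rule has_integral_eq_rhs[OF has_integral_power_sin_step[OF Suc assms(1,2)]], unfold C_def[symmetric])
       (use assms(1,3) in \<open>simp add: field_simps power2_eq_square\<close>)
qed

text \<open>The initial integral of t sin (a t) has no contribution from 0 and is already one
  boundary term, hence \<open>Suc p\<close> summands and no isolated term.\<close>

lemma has_integral_odd_power_sin:
  fixes a b :: real
  assumes "a \<noteq> 0" "0 \<le> b" "cos (a * b) = 0"
  shows "((\<lambda>t. t ^ (2 * p + 1) / fact (2 * p + 1) * sin (a * t)) has_integral
           (-1) ^ p * (sin (a * b) * alt_sum (\<lambda>j. b ^ (2 * j) / fact (2 * j)) a (Suc p))) {0..b}"
proof (induction p)
  case 0
  show ?case using has_integral_id_times_sin[OF assms(1,2)] assms(3) by (simp add: alt_sum_Suc)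
next
  case (Suc p)
  \<comment> \<open>\<open>C\<close> keeps the new boundary coefficient opaque, so that the field
    normalisation does not expand its factorial.\<close>
  define C where "C = b ^ (2 * Suc p) / fact (2 * Suc p)"
  have C: "b ^ (2 * p + 1 + 1) / fact (2 * p + 1 + 1) = C"
    by (simp add: C_def del: fact_Suc)
  have idx: "2 * Suc p + 1 = (2 * p + 1) + 2" "2 * Suc p + 2 = (2 * p + 2) + 2" by simp_all
  show ?case
    unfolding alt_sum_Suc[of _ _ "Suc p"] C_def[symmetric] idx
    by (rule has_integral_eq_rhs[OF has_integral_power_sin_step[OF Suc assms(1,2)]], unfold C)
       (use assms(1,3) in \<open>simp add: field_simps power2_eq_square\<close>)
qed

lemma has_integral_even_power_cos:
  fixes a b :: real
  assumes "a \<noteq> 0" "0 \<le> b" "sin (a * b) = 0"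
  shows "((\<lambda>t. t ^ (2 * p) / fact (2 * p) * cos (a * t)) has_integral
           (-1) ^ p * (- cos (a * b) * alt_sum (\<lambda>j. b ^ (2 * j + 1) / fact (2 * j + 1)) a p)) {0..b}"
proof (induction p)
  case 0
  show ?case using has_integral_cos[OF assms(1,2)] assms(3) by simp
next
  case (Suc p)
  define C where "C = b ^ (2 * p + 1) / fact (2 * p + 1)"
  have idx: "2 * Suc p = 2 * p + 2" by simp
  show ?case
    unfolding alt_sum_Suc C_def[symmetric] idx
    by (rule has_integral_eq_rhs[OF has_integral_power_cos_step[OF Suc assms(1,2)]], unfold C_def[symmetric])
       (use assms(1,3) in \<open>simp add: field_simps power2_eq_square\<close>)
qed

text \<open>Here the initial integral of t cos (a t) does see the endpoint 0, through cos 0 = 1;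
  this is the source of the isolated term.\<close>

lemma has_integral_odd_power_cos:
  fixes a b :: real
  assumes "a \<noteq> 0" "0 \<le> b" "sin (a * b) = 0"
  shows "((\<lambda>t. t ^ (2 * p + 1) / fact (2 * p + 1) * cos (a * t)) has_integral
           (-1) ^ p * (cos (a * b) * alt_sum (\<lambda>j. b ^ (2 * j) / fact (2 * j)) a (Suc p)
             - 1 / a ^ (2 * p + 2))) {0..b}"
proof (induction p)
  case 0
  show ?case using has_integral_id_times_cos[OF assms(1,2)] assms(3)
    by (simp add: alt_sum_Suc diff_divide_distrib power2_eq_square)
next
  case (Suc p)
  define C where "C = b ^ (2 * Suc p) / fact (2 * Suc p)"
  have C: "b ^ (2 * p + 1 + 1) / fact (2 * p + 1 + 1) = C"
    by (simp add: C_def del: fact_Suc)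
  have idx: "2 * Suc p + 1 = (2 * p + 1) + 2" "2 * Suc p + 2 = (2 * p + 2) + 2" by simp_all
  show ?case
    unfolding alt_sum_Suc[of _ _ "Suc p"] C_def[symmetric] idx
    by (rule has_integral_eq_rhs[OF has_integral_power_cos_step[OF Suc assms(1,2)]], unfold C)
       (use assms(1,3) in \<open>simp add: field_simps power2_eq_square\<close>)
qed

lemma trig_odd_times_pi_half:
  "cos ((2 * real k + 1) * (pi / 2)) = 0" "sin ((2 * real k + 1) * (pi / 2)) = (-1) ^ k"
proof -
  have eq: "(2 * real k + 1) * (pi / 2) = real k * pi + pi / 2"
    by (simp add: algebra_simps)
  show "cos ((2 * real k + 1) * (pi / 2)) = 0" "sin ((2 * real k + 1) * (pi / 2)) = (-1) ^ k"
    unfolding eq by (simp_all add: cos_add sin_add)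
qed

lemma trig_even_times_pi_half:
  "cos ((2 * real k) * (pi / 2)) = (-1) ^ k" "sin ((2 * real k) * (pi / 2)) = 0"
proof -
  have eq: "(2 * real k) * (pi / 2) = real k * pi"
    by (simp add: algebra_simps)
  show "cos ((2 * real k) * (pi / 2)) = (-1) ^ k" "sin ((2 * real k) * (pi / 2)) = 0"
    unfolding eq by simp_all
qed

section \<open>Identification of the coefficients\<close>

lemma central_binomial_Suc:
  "real ((2 * Suc k) choose Suc k) * (real k + 1) = 2 * (2 * real k + 1) * real ((2 * k) choose k)"
proof -
  have "Suc k * ((2 * Suc k) choose Suc k) = Suc (2 * k + 1) * ((2 * k + 1) choose k)"
    using Suc_times_binomial_eq[of "2 * k + 1" k] by (simp add: mult_ac)
  also have "\<dots> = Suc k * (2 * ((2 * k + 1) choose k))"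
    by (simp add: algebra_simps)
  finally have 1: "(2 * Suc k) choose Suc k = 2 * ((2 * k + 1) choose k)"
    by (simp only: mult_cancel1 nat.distinct simp_thms)
  have 2: "(2 * k + 1) choose k = (2 * k + 1) choose Suc k"
    using binomial_symmetric[of k "2 * k + 1"] by simp
  have 3: "((2 * k + 1) choose Suc k) * Suc k = (2 * k + 1) * ((2 * k) choose k)"
    using Suc_times_binomial_eq[of "2 * k" k] by (simp add: mult_ac)
  have "((2 * Suc k) choose Suc k) * Suc k = 2 * (2 * k + 1) * ((2 * k) choose k)"
    unfolding 1 2 mult.assoc 3 ..
  then have "real (((2 * Suc k) choose Suc k) * Suc k) = real (2 * (2 * k + 1) * ((2 * k) choose k))"
    by (rule arg_cong)
  then show ?thesis
    by (simp only: of_nat_mult of_nat_add of_nat_Suc of_nat_numeral of_nat_1 add.commute[of 1])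
qed

lemma G_Suc: "G p (Suc k) = G p k + (if p = 0 then 0 else G (p - 1) k / (2 * real k + 1)\<^sup>2)"
  by (cases p) simp_all

text \<open>The factor (2k + 1)^2 in the recursion reproduces the ratio of consecutive central
  binomial coefficients, and the inhomogeneous term is the summand added to \<open>G\<close>. As it
  has index p - 1, the induction on k keeps p arbitrary.\<close>

lemma arcsin_coeff_odd:
  "arcsin_coeff (2 * p + 1) (2 * k + 1) = real ((2 * k) choose k) * G p k / (4 ^ k * (2 * real k + 1))"
proof (induction k arbitrary: p)
  case 0
  show ?case by (cases p) auto
next
  case (Suc k)
  define B where "B = real ((2 * k) choose k)"
  have B: "real ((2 * Suc k) choose Suc k) = 2 * (2 * real k + 1) * B / (real k + 1)"
    using central_binomial_Suc[of k] by (simp add: B_def field_simps del: binomial_Suc_Suc)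
  have prev: "(if 2 * p + 1 < 2 then 0 else arcsin_coeff (2 * p + 1 - 2) (2 * k + 1))
          = (if p = 0 then 0 else B * G (p - 1) k / (4 ^ k * (2 * real k + 1)))"
    using Suc.IH[of "p - 1"] by (cases p) (auto simp: B_def)
  have idx: "2 * Suc k + 1 = Suc (Suc (2 * k + 1))" by simp
  have "arcsin_coeff (2 * p + 1) (2 * Suc k + 1) =
      ((2 * real k + 1)\<^sup>2 * (B * G p k / (4 ^ k * (2 * real k + 1)))
        + (if p = 0 then 0 else B * G (p - 1) k / (4 ^ k * (2 * real k + 1))))
      / ((2 * real k + 3) * (2 * real k + 2))"
    unfolding idx arcsin_coeff.simps(3) prev Suc.IH[of p, folded B_def] by (simp add: add_ac)
  also have "\<dots> = real ((2 * Suc k) choose Suc k) * G p (Suc k) / (4 ^ Suc k * (2 * real (Suc k) + 1))"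
  proof -
    \<comment> \<open>Used with x = 2k + 1, y = k + 1, z = 2k + 3, F = 4^k; abstracting these into
      independent variables leaves a plain rational identity.\<close>
    have alg: "(x\<^sup>2 * (B * a / (F * x)) + (if p = 0 then 0 else B * c / (F * x))) / (z * (2 * y))
               = 2 * x * B / y * (a + (if p = 0 then 0 else c / x\<^sup>2)) / (4 * F * z)"
      if "x \<noteq> 0" "y \<noteq> 0" "z \<noteq> 0" "F \<noteq> 0" for x y z F a c :: real
      using that by (simp add: field_simps power2_eq_square)
    have eqs: "2 * real k + 2 = 2 * (real k + 1)" "2 * real (Suc k) + 1 = 2 * real k + 3"
      by simp_all
    have "2 * real k + 1 \<noteq> 0" "real k + 1 \<noteq> 0" "2 * real k + 3 \<noteq> 0" "(4 :: real) ^ k \<noteq> 0"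
      by auto
    then show ?thesis
      unfolding B G_Suc eqs power_Suc by (rule alg)
  qed
  finally show ?case .
qed

text \<open>The case split on p keeps the unspecified \<open>H 0\<close> out of the
  recurrence.\<close>

lemma H_Suc:
  assumes "k \<ge> 1"
  shows "H (Suc p) (Suc k) = H (Suc p) k + (if p = 0 then 0 else H p k / (2 * real k)\<^sup>2)"
  using assms by (cases p) simp_all

lemma arcsin_coeff_even:
  "arcsin_coeff (2 * p + 2) (2 * k + 2) =
     4 ^ Suc k * H (Suc p) (Suc k) / (real ((2 * Suc k) choose Suc k) * (2 * real k + 2)\<^sup>2)"
proof (induction k arbitrary: p)
  case 0
  show ?case by (cases p) (auto simp: numeral_2_eq_2)
next
  case (Suc k)
  define B where "B = real ((2 * Suc k) choose Suc k)"
  have B: "real ((2 * Suc (Suc k)) choose Suc (Suc k)) = 2 * (2 * real k + 3) * B / (real k + 2)"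
    using central_binomial_Suc[of "Suc k"] by (simp add: B_def field_simps del: binomial_Suc_Suc)
  have "B > 0" by (simp add: B_def del: binomial_Suc_Suc)
  \<comment> \<open>For p = 0 the inhomogeneous series is the constant 1, which has no coefficient
    at the positive exponent 2k + 2.\<close>
  have prev: "(if 2 * p + 2 < 2 then 0 else arcsin_coeff (2 * p + 2 - 2) (2 * k + 2))
          = (if p = 0 then 0 else 4 ^ Suc k * H p (Suc k) / (B * (2 * real k + 2)\<^sup>2))"
  proof (cases p)
    case 0
    then show ?thesis using arcsin_coeff_0[of "2 * k + 2"] by simp
  next
    case (Suc q)
    then show ?thesis using Suc.IH[of q] by (simp add: B_def)
  qed
  have idx: "2 * Suc k + 2 = Suc (Suc (2 * k + 2))" by simp
  have "arcsin_coeff (2 * p + 2) (2 * Suc k + 2) =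
      ((2 * real k + 2)\<^sup>2 * (4 ^ Suc k * H (Suc p) (Suc k) / (B * (2 * real k + 2)\<^sup>2))
        + (if p = 0 then 0 else 4 ^ Suc k * H p (Suc k) / (B * (2 * real k + 2)\<^sup>2)))
      / ((2 * real k + 4) * (2 * real k + 3))"
    unfolding idx arcsin_coeff.simps(3) prev Suc.IH[of p, folded B_def] by (simp add: add_ac)
  also have "\<dots> = 4 ^ Suc (Suc k) * H (Suc p) (Suc (Suc k))
                / (real ((2 * Suc (Suc k)) choose Suc (Suc k)) * (2 * real (Suc k) + 2)\<^sup>2)"
  proof -
    have alg: "(x\<^sup>2 * (F * a / (B * x\<^sup>2)) + (if p = 0 then 0 else F * c / (B * x\<^sup>2))) / (2 * y * z)
               = 4 * F * (a + (if p = 0 then 0 else c / x\<^sup>2)) / (2 * z * B / y * (2 * y)\<^sup>2)"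
      if "x \<noteq> 0" "y \<noteq> 0" "z \<noteq> 0" for x y z F a c :: real
      using that \<open>B > 0\<close> by (simp add: field_simps power2_eq_square)
    have eqs: "2 * real (Suc k) = 2 * real k + 2" "2 * real k + 2 + 2 = 2 * (real k + 2)"
      "2 * real k + 4 = 2 * (real k + 2)"
      by simp_all
    have H: "H (Suc p) (Suc (Suc k)) = H (Suc p) (Suc k) + (if p = 0 then 0 else H p (Suc k) / (2 * real k + 2)\<^sup>2)"
      using H_Suc[of "Suc k" p] by (simp only: eqs)
    have "2 * real k + 2 \<noteq> 0" "real k + 2 \<noteq> 0" "2 * real k + 3 \<noteq> 0"
      by auto
    then show ?thesis
      unfolding B H eqs power_Suc[of 4 "Suc k"] by (rule alg)
  qed
  finally show ?case .
qed

text \<open>Only even n survive by parity, and the factor n + 1 = 2k + 1 from differentiation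
  cancels the one in the coefficient. Taking m = 2l + 1 or m = 2l gives the two denominators of the
  theorem.\<close>

lemma sums_G:
  assumes "((\<lambda>t. sin t ^ m * (t ^ (2 * p) / fact (2 * p))) has_integral L) {0..pi / 2}"
  shows "(\<lambda>k. real ((2 * k) choose k) * G p k / (4 ^ k * (2 * real k + real m + 1))) sums L"
proof -
  let ?f = "\<lambda>n. real (Suc n) * arcsin_coeff (Suc (2 * p)) (Suc n) / real (n + m + 1)"
  have "(\<lambda>k. ?f (2 * k)) sums L \<longleftrightarrow> ?f sums L"
  proof (rule sums_mono_reindex)
    show "strict_mono (\<lambda>k::nat. 2 * k)" by (simp add: strict_mono_def)
    show "?f n = 0" if "n \<notin> range (\<lambda>k. 2 * k)" for n
      using that arcsin_coeff_parity[of "Suc (2 * p)" "Suc n"] by (auto elim!: evenE)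
  qed
  moreover have "?f (2 * k) = real ((2 * k) choose k) * G p k / (4 ^ k * (2 * real k + real m + 1))" for k
  proof -
    define x where "x = 2 * real k + 1"
    have "x \<noteq> 0" by (simp add: x_def)
    have "real (Suc (2 * k)) = x" "real (2 * k + m + 1) = x + real m" "2 * real k + real m + 1 = x + real m"
      by (simp_all add: x_def)
    moreover have "arcsin_coeff (Suc (2 * p)) (Suc (2 * k)) = real ((2 * k) choose k) * G p k / (4 ^ k * x)"
      using arcsin_coeff_odd[of p k] by (simp add: x_def)
    ultimately show ?thesis
      using \<open>x \<noteq> 0\<close> by (simp only:) simp
  qed
  ultimately show ?thesis
    using sums_integral_sin_power[OF assms] by simp
qed

text \<open>Now only odd n survive, and differentiation cancels one of the two factors 2k + 2 in the
  coefficient.\<close>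

lemma sums_H:
  assumes "((\<lambda>t. sin t ^ m * (t ^ (2 * p + 1) / fact (2 * p + 1))) has_integral L) {0..pi / 2}"
  shows "(\<lambda>i. 4 ^ Suc i * H (Suc p) (Suc i) /
           (real ((2 * Suc i) choose Suc i) * (2 * real (Suc i)) * (2 * real (Suc i) + real m))) sums L"
proof -
  let ?f = "\<lambda>n. real (Suc n) * arcsin_coeff (Suc (2 * p + 1)) (Suc n) / real (n + m + 1)"
  have "(\<lambda>k. ?f (2 * k + 1)) sums L \<longleftrightarrow> ?f sums L"
  proof (rule sums_mono_reindex)
    show "strict_mono (\<lambda>k::nat. 2 * k + 1)" by (simp add: strict_mono_def)
    show "?f n = 0" if "n \<notin> range (\<lambda>k. 2 * k + 1)" for n
      using that arcsin_coeff_parity[of "Suc (2 * p + 1)" "Suc n"] by (cases "even n") (auto elim!: oddE)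
  qed
  moreover have "?f (2 * i + 1) = 4 ^ Suc i * H (Suc p) (Suc i) /
      (real ((2 * Suc i) choose Suc i) * (2 * real (Suc i)) * (2 * real (Suc i) + real m))" for i
  proof -
    define B where "B = real ((2 * Suc i) choose Suc i)"
    define x where "x = 2 * real i + 2"
    have "x \<noteq> 0" by (simp add: x_def add_eq_0_iff)
    have "real (Suc (2 * i + 1)) = x" "real (2 * i + 1 + m + 1) = x + real m" "2 * real (Suc i) = x"
      by (simp_all add: x_def)
    moreover have "arcsin_coeff (Suc (2 * p + 1)) (Suc (2 * i + 1)) = 4 ^ Suc i * H (Suc p) (Suc i) / (B * x\<^sup>2)"
      using arcsin_coeff_even[of p i] unfolding B_def x_def by (simp only: Suc_eq_plus1 add.assoc one_add_one)
    ultimately show ?thesis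
      using \<open>x \<noteq> 0\<close> unfolding B_def[symmetric] by (simp only: power2_eq_square) simp
  qed
  ultimately show ?thesis
    using sums_integral_sin_power[OF assms] by simp
qed

section \<open>Evaluation of the series\<close>

lemma sum_mult_alt_sum:
  "(\<Sum>j<p. (\<Sum>k\<in>A. w k / a k ^ (2 * p - 2 * j)) * ((-1) ^ j * c j / d j))
     = (\<Sum>k\<in>A. w k * alt_sum (\<lambda>j. c j / d j) (a k) p)"
  unfolding alt_sum_def sum_distrib_left sum_distrib_right
  by (subst sum.swap) (simp add: mult_ac)

text \<open>Homogeneity: each summand collects 2j + 1 and 2p - 2j factors of two, a total
  independent of j. This converts pi/2 with frequency 2k into pi with k.\<close>

lemma alt_sum_double_odd:
  "alt_sum (\<lambda>j. (x / 2) ^ (2 * j + 1) / d j) (2 * a) p = alt_sum (\<lambda>j. x ^ (2 * j + 1) / d j) a p / 2 ^ (2 * p + 1)"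
  unfolding alt_sum_def sum_divide_distrib
proof (rule sum.cong)
  fix j assume "j \<in> {..<p}"
  then have "(2 :: real) ^ (2 * p + 1) = 2 ^ (2 * j + 1) * 2 ^ (2 * p - 2 * j)"
    by (simp flip: power_add)
  then show "(-1) ^ j * ((x / 2) ^ (2 * j + 1) / d j) / (2 * a) ^ (2 * p - 2 * j) =
      (-1) ^ j * (x ^ (2 * j + 1) / d j) / a ^ (2 * p - 2 * j) / 2 ^ (2 * p + 1)"
    by (simp only: power_divide power_mult_distrib) simp
qed simp

lemma alt_sum_double_even:
  "alt_sum (\<lambda>j. (x / 2) ^ (2 * j) / d j) (2 * a) p = alt_sum (\<lambda>j. x ^ (2 * j) / d j) a p / 2 ^ (2 * p)"
  unfolding alt_sum_def sum_divide_distrib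
proof (rule sum.cong)
  fix j assume "j \<in> {..<p}"
  then have "(2 :: real) ^ (2 * p) = 2 ^ (2 * j) * 2 ^ (2 * p - 2 * j)"
    by (simp flip: power_add)
  then show "(-1) ^ j * ((x / 2) ^ (2 * j) / d j) / (2 * a) ^ (2 * p - 2 * j) =
      (-1) ^ j * (x ^ (2 * j) / d j) / a ^ (2 * p - 2 * j) / 2 ^ (2 * p)"
    by (simp only: power_divide power_mult_distrib) simp
qed simp

lemma has_integral_sin_power_odd:
  assumes "\<And>k. ((\<lambda>t. f t * sin ((2 * real k + 1) * t)) has_integral I k) S"
  shows "((\<lambda>t. sin t ^ (2 * l + 1) * f t) has_integral
           (\<Sum>k=0..l. real ((2 * l + 1) choose (l - k)) * (-1) ^ k * I k) / 4 ^ l) S"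
proof -
  have "((\<lambda>t. (\<Sum>k=0..l. real ((2 * l + 1) choose (l - k)) * (-1) ^ k *
            (f t * sin ((2 * real k + 1) * t))) / 4 ^ l) has_integral
           (\<Sum>k=0..l. real ((2 * l + 1) choose (l - k)) * (-1) ^ k * I k) / 4 ^ l) S"
    by (intro has_integral_divide has_integral_sum has_integral_mult_right assms) auto
  then show ?thesis
    unfolding sin_power_odd by (simp add: sum_distrib_left sum_distrib_right mult_ac)
qed

lemma has_integral_sin_power_even:
  assumes "(f has_integral I0) S"
    and "\<And>k. k \<ge> 1 \<Longrightarrow> ((\<lambda>t. f t * cos (2 * real k * t)) has_integral I k) S"
  shows "((\<lambda>t. sin t ^ (2 * l) * f t) has_integral
           (real ((2 * l) choose l) * I0 +
            2 * (\<Sum>k=1..l. real ((2 * l) choose (l - k)) * (-1) ^ k * I k)) / 4 ^ l) S"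
proof -
  have "((\<lambda>t. (real ((2 * l) choose l) * f t +
            2 * (\<Sum>k=1..l. real ((2 * l) choose (l - k)) * (-1) ^ k *
            (f t * cos (2 * real k * t)))) / 4 ^ l) has_integral
           (real ((2 * l) choose l) * I0 +
            2 * (\<Sum>k=1..l. real ((2 * l) choose (l - k)) * (-1) ^ k * I k)) / 4 ^ l) S"
    by (intro has_integral_divide has_integral_add has_integral_sum has_integral_mult_right assms) auto
  then show ?thesis
    unfolding sin_power_even
    by (simp add: sum_distrib_left sum_distrib_right distrib_left distrib_right mult_ac)
qed

text \<open>The integer exponent gives the sign -1 at p = 0, where natural subtraction would give
  +1.\<close>

lemma minus_one_powi_pred: "(-1 :: real) powi (int p - 1) = - ((-1) ^ p)"
  by (simp add: power_int_diff)

text \<open>The sign (-1)^k in the expansion of sin^m t cancels the value (-1)^k of the sine or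
  cosine at pi/2. It survives only in the isolated terms, which come from the endpoint 0.\<close>

lemma neg_one_power_square: "(-1) ^ k * ((-1) ^ k * x) = (x :: real)"
  by (simp add: mult.assoc[symmetric] flip: power_mult_distrib)

lemma sums_G_odd:
  "(\<lambda>k. real ((2 * k) choose k) * G p k / (4 ^ k * (2 * real k + 2 * real l + 2))) sums
     ((-1) powi (int p - 1) / 4 ^ l *
        (\<Sum>j<p. (\<Sum>k=0..l. real ((2*l+1) choose (l-k)) / (2 * real k + 1)^(2*p - 2*j))
                * ((-1)^j * (pi/2)^(2*j+1) / fact (2*j+1)))
      + (-1)^p / 4^l *
        (\<Sum>k=0..l. real ((2*l+1) choose (l-k)) * (-1)^k / (2 * real k + 1)^(2*p+1)))"
  (is "?f sums ?L")
proof -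
  let ?w = "\<lambda>k. real ((2*l+1) choose (l-k))"
  let ?A = "\<lambda>k. alt_sum (\<lambda>j. (pi/2)^(2*j+1) / fact (2*j+1)) (2 * real k + 1) p"
  have "((\<lambda>t. sin t ^ (2 * l + 1) * (t ^ (2 * p) / fact (2 * p))) has_integral
      (\<Sum>k=0..l. ?w k * (-1) ^ k * ((-1) ^ p * (1 / (2 * real k + 1) ^ (2 * p + 1) - (-1) ^ k * ?A k))) / 4 ^ l)
      {0..pi / 2}"
    by (rule has_integral_sin_power_odd,
        rule has_integral_even_power_sin[OF _ pi_half_ge_zero trig_odd_times_pi_half(1), unfolded trig_odd_times_pi_half])
       simp
  also have "(\<Sum>k=0..l. ?w k * (-1) ^ k * ((-1) ^ p * (1 / (2 * real k + 1) ^ (2 * p + 1) - (-1) ^ k * ?A k))) / 4 ^ l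
      = ?L"
    unfolding sum_mult_alt_sum minus_one_powi_pred sum_divide_distrib sum_distrib_left sum.distrib[symmetric]
    by (intro sum.cong refl) (simp add: algebra_simps neg_one_power_square diff_divide_distrib)
  finally have "(\<lambda>k. real ((2 * k) choose k) * G p k / (4 ^ k * (2 * real k + real (2 * l + 1) + 1))) sums ?L"
    by (rule sums_G)
  then show ?thesis by (simp add: add_ac)
qed

lemma sums_G_even:
  "(\<lambda>k. real ((2*k) choose k) * G p k / (4^k * (2 * real k + 2 * real l + 1))) sums
     ((-1) powi (int p - 1) / 4^(l+p) *
        (\<Sum>j<p. (\<Sum>k=1..l. real ((2*l) choose (l-k)) / real k^(2*p - 2*j))
                * ((-1)^j * pi^(2*j+1) / fact (2*j+1)))
      + real ((2*l) choose l) / 2^(2*l+2*p+1) * (pi^(2*p+1) / fact (2*p+1)))"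
  (is "?f sums ?L")
proof -
  let ?w = "\<lambda>k. real ((2*l) choose (l-k))"
  let ?c = "\<lambda>x j. x^(2*j+1) / fact (2*j+1) :: real"
  let ?A = "\<lambda>k. alt_sum (?c (pi / 2)) (2 * real k) p"
  let ?V = "(real ((2 * l) choose l) * ((pi / 2) ^ Suc (2 * p) / fact (Suc (2 * p))) +
        2 * (\<Sum>k=1..l. ?w k * (-1) ^ k * ((-1) ^ p * (- ((-1) ^ k) * ?A k)))) / 4 ^ l"
  have "((\<lambda>t. sin t ^ (2 * l) * (t ^ (2 * p) / fact (2 * p))) has_integral ?V) {0..pi / 2}"
    by (rule has_integral_sin_power_even, rule has_integral_power_fact[OF pi_half_ge_zero],
        rule has_integral_even_power_cos[OF _ pi_half_ge_zero trig_even_times_pi_half(2), unfolded trig_even_times_pi_half])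
       simp
  also have "?V = ?L"
  proof -
    \<comment> \<open>The factor 2 of the paired modes meets 2^(2p+1) from the rescaling; together
      with 4^l this leaves the prefactor 1 / 4^(l+p).\<close>
    have pow: "(2 :: real) ^ (2 * p + 1) = 2 * 4 ^ p"
      by (simp add: power_mult)
    have "2 * (\<Sum>k=1..l. ?w k * (-1) ^ k * ((-1) ^ p * (- ((-1) ^ k) * ?A k))) / 4 ^ l
        = - ((-1) ^ p) / 4 ^ (l + p) * (\<Sum>k=1..l. ?w k * alt_sum (?c pi) (real k) p)"
      unfolding alt_sum_double_odd sum_divide_distrib sum_distrib_left pow
      by (intro sum.cong refl) (simp add: algebra_simps neg_one_power_square power_add)
    moreover have "real ((2 * l) choose l) * ((pi / 2) ^ Suc (2 * p) / fact (Suc (2 * p))) / 4 ^ l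
        = real ((2*l) choose l) / 2^(2*l+2*p+1) * ?c pi p"
      by (simp add: power_divide power_add power_mult del: fact_Suc)
    ultimately show ?thesis
      unfolding sum_mult_alt_sum minus_one_powi_pred add_divide_distrib by (simp only: add.commute)
  qed
  finally have "(\<lambda>k. real ((2 * k) choose k) * G p k / (4 ^ k * (2 * real k + real (2 * l) + 1))) sums ?L"
    by (rule sums_G)
  then show ?thesis by simp
qed

lemma sums_H_odd:
  "(\<lambda>i. 4 ^ Suc i * H (Suc q) (Suc i) /
      (real ((2 * Suc i) choose Suc i) * (2 * real (Suc i)) * (2 * real (Suc i) + 2 * real l + 1))) sums
     ((-1)^q / 4^l *
        (\<Sum>j<Suc q. (\<Sum>k=0..l. real ((2*l+1) choose (l-k)) / (2 * real k + 1)^(2*Suc q - 2*j))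
                * ((-1)^j * (pi/2)^(2*j) / fact (2*j))))"
  (is "?f sums ?L")
proof -
  let ?w = "\<lambda>k. real ((2*l+1) choose (l-k))"
  let ?A = "\<lambda>k. alt_sum (\<lambda>j. (pi/2)^(2*j) / fact (2*j)) (2 * real k + 1) (Suc q)"
  have "((\<lambda>t. sin t ^ (2 * l + 1) * (t ^ (2 * q + 1) / fact (2 * q + 1))) has_integral
      (\<Sum>k=0..l. ?w k * (-1) ^ k * ((-1) ^ q * ((-1) ^ k * ?A k))) / 4 ^ l) {0..pi / 2}"
    by (rule has_integral_sin_power_odd,
        rule has_integral_odd_power_sin[OF _ pi_half_ge_zero trig_odd_times_pi_half(1), unfolded trig_odd_times_pi_half])
       simp
  also have "(\<Sum>k=0..l. ?w k * (-1) ^ k * ((-1) ^ q * ((-1) ^ k * ?A k))) / 4 ^ l = ?L"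
    unfolding sum_mult_alt_sum sum_divide_distrib sum_distrib_left
    by (intro sum.cong refl) (simp add: algebra_simps neg_one_power_square)
  finally have "(\<lambda>i. 4 ^ Suc i * H (Suc q) (Suc i) /
      (real ((2 * Suc i) choose Suc i) * (2 * real (Suc i)) * (2 * real (Suc i) + real (2 * l + 1)))) sums ?L"
    by (rule sums_H)
  moreover have "real (2 * l + 1) = 2 * real l + 1" by simp
  ultimately show ?thesis by (simp only: add.assoc)
qed

text \<open>All three sources contribute: boundary terms at pi/2, the constant mode of sin^(2l) t
  with its pure power of pi, and the isolated terms from 0 with their alternating sign.\<close>

lemma sums_H_even:
  "(\<lambda>i. 4 ^ Suc i * H (Suc q) (Suc i) /
      (real ((2 * Suc i) choose Suc i) * (2 * real (Suc i)) * (2 * real (Suc i) + 2 * real l))) sums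
     ((-1)^q / 2^(2*l+2*Suc q-1) *
        (\<Sum>j<Suc q. (\<Sum>k=1..l. real ((2*l) choose (l-k)) / real k^(2*Suc q - 2*j))
                * ((-1)^j * pi^(2*j) / fact (2*j)))
      + real ((2*l) choose l) / 4^(l+Suc q) * (pi^(2*Suc q) / fact (2*Suc q))
      + (-1)^Suc q / 2^(2*l+2*Suc q-1) *
        (\<Sum>k=1..l. real ((2*l) choose (l-k)) * (-1)^k / real k^(2*Suc q)))"
  (is "?f sums ?L")
proof -
  let ?w = "\<lambda>k. real ((2*l) choose (l-k))"
  let ?c = "\<lambda>x j. x^(2*j) / fact (2*j) :: real"
  let ?A = "\<lambda>k. alt_sum (?c (pi / 2)) (2 * real k) (Suc q)"
  let ?V = "(real ((2 * l) choose l) * ((pi / 2) ^ Suc (2 * q + 1) / fact (Suc (2 * q + 1))) +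
        2 * (\<Sum>k=1..l. ?w k * (-1) ^ k * ((-1) ^ q * ((-1) ^ k * ?A k - 1 / (2 * real k) ^ (2 * q + 2))))) / 4 ^ l"
  have "((\<lambda>t. sin t ^ (2 * l) * (t ^ (2 * q + 1) / fact (2 * q + 1))) has_integral ?V) {0..pi / 2}"
    by (rule has_integral_sin_power_even, rule has_integral_power_fact[OF pi_half_ge_zero],
        rule has_integral_odd_power_cos[OF _ pi_half_ge_zero trig_even_times_pi_half(2), unfolded trig_even_times_pi_half])
       simp
  also have "?V = ?L"
  proof -
    have pow: "(2 :: real) ^ (2 * l + 2 * Suc q - 1) = 2 * 4 ^ l * 4 ^ q" "2 ^ (2 * Suc q) = 4 * (4 :: real) ^ q"
      by (simp_all add: power_add power_mult)
    have "2 * (\<Sum>k=1..l. ?w k * (-1) ^ k * ((-1) ^ q * ((-1) ^ k * ?A k - 1 / (2 * real k) ^ (2 * q + 2)))) / 4 ^ l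
        = (-1) ^ q / 2^(2*l+2*Suc q-1) * (\<Sum>k=1..l. ?w k * alt_sum (?c pi) (real k) (Suc q))
          + (-1)^Suc q / 2^(2*l+2*Suc q-1) * (\<Sum>k=1..l. ?w k * (-1)^k / real k^(2*Suc q))"
      unfolding alt_sum_double_even sum_divide_distrib sum_distrib_left sum.distrib[symmetric] pow
    proof (intro sum.cong refl)
      fix k assume "k \<in> {1..l}"
      define X where "X = real k ^ (2 * Suc q)"
      have "(2 * real k) ^ (2 * q + 2) = 4 * 4 ^ q * X"
        by (simp add: X_def power_mult power_mult_distrib)
      moreover have "X \<noteq> 0" using \<open>k \<in> {1..l}\<close> by (simp add: X_def)
      ultimately show "2 * (?w k * (-1) ^ k * ((-1) ^ q *
            ((-1) ^ k * (alt_sum (?c pi) (real k) (Suc q) / (4 * 4 ^ q)) - 1 / (2 * real k) ^ (2 * q + 2)))) / 4 ^ l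
          = (-1) ^ q / (2 * 4 ^ l * 4 ^ q) * (?w k * alt_sum (?c pi) (real k) (Suc q))
            + (-1) ^ Suc q / (2 * 4 ^ l * 4 ^ q) * (?w k * (-1) ^ k / real k ^ (2 * Suc q))"
        unfolding X_def[symmetric]
        by (simp add: algebra_simps neg_one_power_square diff_divide_distrib)
    qed
    moreover have "real ((2 * l) choose l) * ((pi / 2) ^ Suc (2 * q + 1) / fact (Suc (2 * q + 1))) / 4 ^ l
        = real ((2*l) choose l) / 4^(l+Suc q) * ?c pi (Suc q)"
      by (simp add: power_divide power_add power_mult del: fact_Suc)
    ultimately show ?thesis
      unfolding sum_mult_alt_sum add_divide_distrib by (simp only: add_ac)
  qed
  finally have "(\<lambda>i. 4 ^ Suc i * H (Suc q) (Suc i) /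
      (real ((2 * Suc i) choose Suc i) * (2 * real (Suc i)) * (2 * real (Suc i) + real (2 * l)))) sums ?L"
    by (rule sums_H)
  then show ?thesis by (simp only: of_nat_mult of_nat_numeral)
qed

theorem corollary3p2:
  shows
    "(\<forall>(l::nat) (p::nat).
         ((\<lambda>k. real ((2*k) choose k) * G p k / (4^k * (2 * real k + 2 * real l + 2)))
       sums
         ((-1) powi (int p - 1) / 4^l *
            (\<Sum>j<p. (\<Sum>k=0..l. real ((2*l+1) choose (l-k)) / (2 * real k + 1)^(2*p - 2*j))
                    * ((-1)^j * (pi/2)^(2*j+1) / fact (2*j+1)))
          + (-1)^p / 4^l *
            (\<Sum>k=0..l. real ((2*l+1) choose (l-k)) * (-1)^k / (2 * real k + 1)^(2*p+1))))
       \<and>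
         ((\<lambda>k. real ((2*k) choose k) * G p k / (4^k * (2 * real k + 2 * real l + 1)))
       sums
         ((-1) powi (int p - 1) / 4^(l+p) *
            (\<Sum>j<p. (\<Sum>k=1..l. real ((2*l) choose (l-k)) / real k^(2*p - 2*j))
                    * ((-1)^j * pi^(2*j+1) / fact (2*j+1)))
          + real ((2*l) choose l) / 2^(2*l+2*p+1) * (pi^(2*p+1) / fact (2*p+1)))))
     \<and>
     (\<forall>(l::nat) (p::nat). p \<ge> 1 \<longrightarrow>
         ((\<lambda>m. let k = Suc m in
          4^k * H p k / (real ((2*k) choose k) * (2 * real k) * (2 * real k + 2 * real l + 1)))
       sums
         ((-1)^(p - 1) / 4^l *
            (\<Sum>j<p. (\<Sum>k=0..l. real ((2*l+1) choose (l-k)) / (2 * real k + 1)^(2*p - 2*j))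
                    * ((-1)^j * (pi/2)^(2*j) / fact (2*j)))))
       \<and>
         ((\<lambda>m. let k = Suc m in
          4^k * H p k / (real ((2*k) choose k) * (2 * real k) * (2 * real k + 2 * real l)))
       sums
         ((-1)^(p - 1) / 2^(2*l+2*p-1) *
            (\<Sum>j<p. (\<Sum>k=1..l. real ((2*l) choose (l-k)) / real k^(2*p - 2*j))
                    * ((-1)^j * pi^(2*j) / fact (2*j)))
          + real ((2*l) choose l) / 4^(l+p) * (pi^(2*p) / fact (2*p))
          + (-1)^p / 2^(2*l+2*p-1) *
            (\<Sum>k=1..l. real ((2*l) choose (l-k)) * (-1)^k / real k^(2*p)))))"
proof (intro conjI allI impI)
  fix l p :: nat
  assume "p \<ge> 1"
  \<comment> \<open>The integrals are indexed by q = p - 1, because \<open>H\<close> with index p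
    goes with the power t^(2p-1) = t^(2q+1).\<close>
  then obtain q where p: "p = Suc q"
    by (cases p) auto
  show "(\<lambda>m. let k = Suc m in
          4^k * H p k / (real ((2*k) choose k) * (2 * real k) * (2 * real k + 2 * real l + 1)))
       sums
         ((-1)^(p - 1) / 4^l *
            (\<Sum>j<p. (\<Sum>k=0..l. real ((2*l+1) choose (l-k)) / (2 * real k + 1)^(2*p - 2*j))
                    * ((-1)^j * (pi/2)^(2*j) / fact (2*j))))"
    using sums_H_odd[of q l] unfolding p Let_def diff_Suc_1 .
  show "(\<lambda>m. let k = Suc m in
          4^k * H p k / (real ((2*k) choose k) * (2 * real k) * (2 * real k + 2 * real l)))
       sums
         ((-1)^(p - 1) / 2^(2*l+2*p-1) *
            (\<Sum>j<p. (\<Sum>k=1..l. real ((2*l) choose (l-k)) / real k^(2*p - 2*j))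
                    * ((-1)^j * pi^(2*j) / fact (2*j)))
          + real ((2*l) choose l) / 4^(l+p) * (pi^(2*p) / fact (2*p))
          + (-1)^p / 2^(2*l+2*p-1) *
            (\<Sum>k=1..l. real ((2*l) choose (l-k)) * (-1)^k / real k^(2*p)))"
    using sums_H_even[of q l] unfolding p Let_def diff_Suc_1 .
qed (rule sums_G_odd sums_G_even)+

end
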